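(* Let $\mu>0$ and let $f:\mathbb{R}^d\to\mathbb{R}$ be a differentiable function. Then $f$ is $\mu$-strongly-convex if and only if one of the following conditions holds (that is, each of the three conditions is individually equivalent to $\mu$-strong-convexity of $f$): (a) $f^*(\lambda u+(1-\lambda)v)\ge \lambda f^*(u)+(1-\lambda)f^*(v)-\frac{1}{2\mu}\lambda(1-\lambda)\|u-v\|^2$ for all $u,v\in\mathbb{R}^d$, $\lambda\in[0,1]$; (b) $\langle\nabla f^*(u)-\nabla f^*(v),u-v\rangle\le\frac1\mu\|u-v\|^2$ for all $u,v\in\mathbb{R}^d$; (c) $f^*(u)\le f^*(v)+\langle\nabla f^*(v),u-v\rangle+\frac{1}{2\mu}\|u-v\|^2$ for all $u,v\in\mathbb{R}^d$.
   Context: $\mathbb{R}^d$ carries the dot product $\langle x,y\rangle=\sum_{i=1}^d x_iy_i$ and the induced norm $\|\cdot\|=\sqrt{\langle\cdot,\cdot\rangle}$. The conjugate of $f$ is $f^*(u)=\sup_{x\in\mathbb{R}^d}\{\langle x,u\rangle-f(x)\}$, and $\nabla f^*$ denotes its gradient. For a differentiable function $h$, the Bregman distance is $D_h(x,y):=h(x)-h(y)-\langle\nabla h(y),x-y\rangle$. Let $\varphi_0=\frac12\|\cdot\|^2$. A differentiable function $f:\mathbb{R}^d\to\mathbb{R}$ is called $\mu$-strongly-convex if $\mu\,D_{\varphi_0}(x,y)\le D_f(x,y)$ for all $x,y\in\mathbb{R}^d$.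
   Formalization: Condition (a) also requires f* not to be identically +∞ (otherwise f = −½‖x‖² satisfies (a) as ∞ ≥ ∞ without being strongly convex); conditions (b) and (c) state explicitly that f* is finite and differentiable everywhere. *)

theory Defs
  imports "HOL-Analysis.Analysis"
begin

definition grad :: "('a::euclidean_space \<Rightarrow> real) \<Rightarrow> 'a \<Rightarrow> 'a" where
  "grad h x = (THE D. GDERIV h x :> D)"

lemma grad_eqI:
  assumes "GDERIV h x :> D"
  shows "grad h x = D"
  unfolding grad_def
proof (rule the_equality)
  show "GDERIV h x :> D" by (rule assms)
next
  fix D' assume "GDERIV h x :> D'"
  then have "(\<lambda>v. inner v D') = (\<lambda>v. inner v D)"
    using assms unfolding gderiv_def by (rule has_derivative_unique)
  then show "D' = D"
    by (metis vector_eq_rdot inner_commute)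
qed

definition bregman :: "('a::euclidean_space \<Rightarrow> real) \<Rightarrow> 'a \<Rightarrow> 'a \<Rightarrow> real" where
  "bregman h x y = h x - h y - inner (grad h y) (x - y)"

definition phi0 :: "'a::euclidean_space \<Rightarrow> real" where
  "phi0 x = 1 / 2 * (norm x)\<^sup>2"

definition strongly_convex :: "real \<Rightarrow> ('a::euclidean_space \<Rightarrow> real) \<Rightarrow> bool" where
  "strongly_convex \<mu> f \<longleftrightarrow>
     (\<forall>x. f differentiable (at x)) \<and> (\<forall>x y. \<mu> * bregman phi0 x y \<le> bregman f x y)"

text \<open>The supremum may be \<open>+\<infinity>\<close>, so the conjugate takes extended real values. As \<open>f\<close> is
  finite, it never takes the value \<open>-\<infinity>\<close>.\<close>

definition fenchel_conjugate :: "('a::euclidean_space \<Rightarrow> real) \<Rightarrow> 'a \<Rightarrow> ereal" where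
  "fenchel_conjugate f u = (SUP x. ereal (inner x u - f x))"

text \<open>Properness excludes \<open>f\<^sup>* \<equiv> \<infinity>\<close> (e.g. \<open>f = - phi0\<close>), for which a concavity-type
  inequality on \<open>f\<^sup>*\<close> would hold vacuously as \<open>\<infinity> \<ge> \<infinity>\<close>.\<close>

definition proper :: "('a \<Rightarrow> ereal) \<Rightarrow> bool" where
  "proper F \<longleftrightarrow> (\<forall>u. F u \<noteq> -\<infinity>) \<and> (\<exists>u. F u \<noteq> \<infinity>)"

text \<open>Since \<open>real_of_ereal\<close> sends infinite values to 0, differentiability of an extended-real-valued
  function at a point explicitly requires finiteness in a neighbourhood of that point;
  \<open>egrad F u\<close> is meaningful only where \<open>F\<close> is differentiable in this sense.\<close>

definition edifferentiable_at :: "('a::euclidean_space \<Rightarrow> ereal) \<Rightarrow> 'a \<Rightarrow> bool" where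
  "edifferentiable_at F u \<longleftrightarrow>
     (\<forall>\<^sub>F w in nhds u. \<bar>F w\<bar> \<noteq> \<infinity>) \<and> (\<lambda>w. real_of_ereal (F w)) differentiable (at u)"

definition egrad :: "('a::euclidean_space \<Rightarrow> ereal) \<Rightarrow> 'a \<Rightarrow> 'a" where
  "egrad F u = grad (\<lambda>w. real_of_ereal (F w)) u"

end

theory Submission
  imports Defs
begin

text \<open>
  Write \<open>G\<close> for the conjugate of \<open>f\<close>. Everything rests on one observation: if \<open>x\<close> maximises
  \<open>\<langle>\<cdot>, v\<rangle> - f\<close>, then \<open>x\<close> is a subgradient of \<open>G\<close> at \<open>v\<close> (the Fenchel--Young inequality is an
  equality there), and \<open>v\<close> is the gradient of \<open>f\<close> at \<open>x\<close> (first-order condition). Maximisers exist as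
  soon as \<open>G\<close> is finite everywhere, because a finite convex function is bounded on balls and this
  makes \<open>f\<close> grow faster than any linear function (\<open>attains_tilted_minimum\<close>).

  Call (a) the near-concavity inequality, (b) the gradient bound and (c) the quadratic upper bound.
  The hub is (c). If \<open>f\<close> is strongly convex, bounding \<open>f\<close> from below by the
  quadratic at a maximiser \<open>x\<close> and conjugating bounds \<open>G\<close> from above by a quadratic with slope \<open>x\<close>.
  Together with the subgradient inequality this sandwiches \<open>G\<close> between an affine function and its
  quadratic perturbation, so \<open>G\<close> is differentiable with gradient \<open>x\<close>. Under (a) the same sandwich
  arises by comparing \<open>v\<close> with \<open>u\<close> and a point slightly beyond \<open>v\<close>. Finally (b) and (c) are
  equivalent by integration along segments and by adding two copies of (c), and (c) at the point
  \<open>t u + (1 - t) v\<close> yields (a).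

  For the way back from (c) to \<open>f\<close>, note that \<open>f\<close> is not assumed convex, so it has to be shown that
  \<open>f\<close> agrees with its biconjugate (\<open>conjugate_maximiser_at\<close>). Given \<open>y\<close>, the roles of \<open>f\<close> and \<open>G\<close>
  can be exchanged in the existence argument: \<open>G - \<langle>y, \<cdot>\<rangle>\<close> attains its minimum at some \<open>v\<close>, whence
  the gradient of \<open>G\<close> at \<open>v\<close> is \<open>y\<close>. But any maximiser of \<open>\<langle>\<cdot>, v\<rangle> - f\<close> is a subgradient of \<open>G\<close> at
  \<open>v\<close> and therefore equals this gradient, that is, \<open>y\<close> itself is the maximiser. Conjugating (c) at
  this \<open>v\<close> gives the strong convexity inequality at \<open>y\<close>.
\<close>

section \<open>Gradients, subgradients and minimisers\<close>

lemma GDERIV_grad: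
  assumes "h differentiable (at x)"
  shows "GDERIV h x :> grad h x"
proof -
  obtain h' where h': "(h has_derivative h') (at x)"
    using assms unfolding differentiable_def by blast
  then have "bounded_linear h'" by (rule has_derivative_bounded_linear)
  then have lin: "linear h'" by (rule bounded_linear.linear)
  define D where "D = (\<Sum>b\<in>Basis. h' b *\<^sub>R b)"
  have "h' v = inner v D" for v
  proof -
    have "h' v = h' (\<Sum>b\<in>Basis. inner v b *\<^sub>R b)" by (simp add: euclidean_representation)
    also have "\<dots> = (\<Sum>b\<in>Basis. inner v b * h' b)"
      using lin by (simp add: linear_sum linear_scale)
    also have "\<dots> = inner v D"
      by (simp add: D_def inner_sum_right mult.commute)
    finally show ?thesis .
  qed
  then have "h' = (\<lambda>v. inner v D)" by blast
  with h' have "GDERIV h x :> D" unfolding gderiv_def by simp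
  then show ?thesis using grad_eqI by metis
qed

lemma subgradient_eq_gradient:
  fixes h :: "'a::euclidean_space \<Rightarrow> real"
  assumes "GDERIV h v :> D" and "\<And>u. h v + inner x (u - v) \<le> h u"
  shows "x = D"
proof -
  have "((\<lambda>u. h u - inner x u) has_derivative (\<lambda>d. inner d D - inner x d)) (at v)"
    using assms(1) unfolding gderiv_def by (auto intro!: derivative_eq_intros)
  moreover have "\<forall>u. h v - inner x v \<le> h u - inner x u"
    using assms(2) by (auto simp: inner_diff_right algebra_simps)
  ultimately have "(\<lambda>d. inner d D - inner x d) = (\<lambda>d. 0)"
    using differential_zero_maxmin[of v UNIV "\<lambda>u. h u - inner x u"] by auto
  then have "inner (x - D) D - inner x (x - D) = 0" by (rule fun_cong)
  then have "inner (x - D) (x - D) = 0"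
    by (simp add: inner_diff_left inner_diff_right inner_commute)
  then show ?thesis by simp
qed

lemma GDERIV_of_quadratic_sandwich:
  fixes h :: "'a::euclidean_space \<Rightarrow> real"
  assumes lower: "\<And>u. h v + inner x (u - v) \<le> h u"
    and upper: "\<And>u. h u \<le> h v + inner x (u - v) + K * (norm (u - v))\<^sup>2"
  shows "GDERIV h v :> x"
proof -
  have "((\<lambda>u. K * norm (u - v)) \<longlongrightarrow> K * norm (v - v)) (at v)"
    by (intro tendsto_intros)
  then have lim: "((\<lambda>u. K * norm (u - v)) \<longlongrightarrow> 0) (at v)" by simp
  have "((\<lambda>u. ((h u - h v) - inner (u - v) x) /\<^sub>R norm (u - v)) \<longlongrightarrow> 0) (at v)"
  proof (rule Lim_null_comparison[OF _ lim])
    have "norm (((h u - h v) - inner (u - v) x) /\<^sub>R norm (u - v)) \<le> K * norm (u - v)"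
      if "u \<noteq> v" for u
    proof -
      have "\<bar>(h u - h v) - inner (u - v) x\<bar> \<le> K * (norm (u - v))\<^sup>2"
        using lower[of u] upper[of u] by (simp add: inner_commute)
      then have "\<bar>(h u - h v) - inner (u - v) x\<bar> / norm (u - v)
          \<le> K * (norm (u - v))\<^sup>2 / norm (u - v)"
        by (rule divide_right_mono) simp
      moreover have "norm (((h u - h v) - inner (u - v) x) /\<^sub>R norm (u - v))
          = \<bar>(h u - h v) - inner (u - v) x\<bar> / norm (u - v)"
        by (simp add: abs_mult divide_inverse_commute)
      moreover have "K * (norm (u - v))\<^sup>2 / norm (u - v) = K * norm (u - v)"
        using that by (simp add: power2_eq_square)
      ultimately show ?thesis by simp
    qed
    then show "\<forall>\<^sub>F u in at v. norm (((h u - h v) - inner (u - v) x) /\<^sub>R norm (u - v))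
        \<le> K * norm (u - v)"
      unfolding eventually_at_filter by (simp add: always_eventually)
  qed
  then show ?thesis
    unfolding gderiv_def has_derivative_at_within
    by (simp add: bounded_linear_inner_left diff_diff_eq)
qed

text \<open>Testing the Fenchel--Young inequality with \<open>u + x / norm x\<close> instead of \<open>u\<close> gains a term
  \<open>norm x\<close>, at the cost of the supremum of \<open>G\<close> over the unit ball around \<open>u\<close>. The hypotheses are
  symmetric in \<open>f\<close> and \<open>G\<close>, so the lemma yields minimisers of \<open>f\<close> and of its conjugate alike.\<close>

lemma attains_tilted_minimum:
  fixes f G :: "'a::euclidean_space \<Rightarrow> real"
  assumes fy: "\<And>x u. inner x u \<le> f x + G u"
    and cf: "continuous_on UNIV f" and cG: "continuous_on UNIV G"
  obtains x where "\<And>y. f x - inner x u \<le> f y - inner y u"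
proof -
  define h where "h = (\<lambda>y. f y - inner y u)"
  have "compact (G ` cball u 1)"
    using cG by (intro compact_continuous_image) (auto intro: continuous_on_subset)
  then obtain C where C: "\<And>w. w \<in> cball u 1 \<Longrightarrow> norm (G w) \<le> C"
    using compact_imp_bounded bounded_iff by (metis imageI)
  have grow: "norm y - C \<le> h y" for y
  proof -
    define w where "w = u + sgn y"
    have "w \<in> cball u 1" by (simp add: w_def dist_norm norm_sgn)
    then have "G w \<le> C" using C by fastforce
    moreover have "inner y w = inner y u + norm y"
      by (cases "y = 0") (simp_all add: w_def inner_add_right sgn_div_norm
          power2_norm_eq_inner[symmetric] power2_eq_square)
    ultimately show ?thesis using fy[of y w] by (simp add: h_def)
  qed
  \<comment> \<open>Outside the ball of radius \<open>R\<close> the growth bound already exceeds \<open>h 0\<close>.\<close>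
  define R where "R = \<bar>C + h 0\<bar>"
  have "continuous_on (cball 0 R) h"
    unfolding h_def by (intro continuous_intros continuous_on_subset[OF cf]) auto
  moreover have "cball 0 R \<noteq> ({} :: 'a set)" by (simp add: R_def)
  ultimately obtain x where x: "\<And>y. y \<in> cball 0 R \<Longrightarrow> h x \<le> h y"
    using continuous_attains_inf[of "cball 0 R" h] compact_cball by metis
  have "h x \<le> h y" for y
  proof (cases "y \<in> cball 0 R")
    case False
    then have "h 0 \<le> h y" using grow[of y] by (auto simp: R_def)
    moreover have "h x \<le> h 0" by (rule x) (simp add: R_def)
    ultimately show ?thesis by simp
  qed (rule x)
  then show thesis unfolding h_def by (rule that)
qed

section \<open>Finite conjugates\<close>

lemma fenchel_young:
  assumes "\<And>u. fenchel_conjugate f u = ereal (G u)"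
  shows "inner x u \<le> f x + G u"
proof -
  have "ereal (inner x u - f x) \<le> fenchel_conjugate f u"
    unfolding fenchel_conjugate_def by (rule SUP_upper) simp
  then show ?thesis using assms by simp
qed

lemma conjugate_least:
  assumes "\<And>u. fenchel_conjugate f u = ereal (G u)"
    and "\<And>x. inner x u - f x \<le> c"
  shows "G u \<le> c"
proof -
  have "fenchel_conjugate f u \<le> ereal c"
    unfolding fenchel_conjugate_def using assms(2) by (auto intro: SUP_least)
  then show ?thesis using assms(1) by simp
qed

lemma conjugate_finiteI:
  assumes "fenchel_conjugate f u < \<infinity>"
  shows "\<bar>fenchel_conjugate f u\<bar> \<noteq> \<infinity>"
proof -
  have "ereal (inner 0 u - f 0) \<le> fenchel_conjugate f u"
    unfolding fenchel_conjugate_def by (rule SUP_upper) simp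
  then show ?thesis using assms by auto
qed

lemma conjugate_continuous:
  assumes fc: "\<And>u. fenchel_conjugate f u = ereal (G u)"
  shows "continuous_on UNIV G"
proof (rule convex_on_continuous)
  show "convex_on UNIV G"
  proof (rule convex_onI)
    fix t u v assume t: "(0::real) < t" "t < 1"
    show "G ((1 - t) *\<^sub>R u + t *\<^sub>R v) \<le> (1 - t) * G u + t * G v"
    proof (rule conjugate_least[OF fc])
      fix x
      have "(1 - t) * inner x u \<le> (1 - t) * (f x + G u)" "t * inner x v \<le> t * (f x + G v)"
        using t fenchel_young[OF fc] by (auto intro!: mult_left_mono)
      then show "inner x ((1 - t) *\<^sub>R u + t *\<^sub>R v) - f x \<le> (1 - t) * G u + t * G v"
        by (simp add: inner_add_right algebra_simps)
    qed
  qed simp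
qed simp

lemma conjugate_attained:
  assumes fc: "\<And>u. fenchel_conjugate f u = ereal (G u)" and cf: "continuous_on UNIV f"
  obtains x where "G u = inner x u - f x"
proof -
  obtain x where x: "\<And>y. f x - inner x u \<le> f y - inner y u"
    using attains_tilted_minimum[OF fenchel_young[OF fc] cf conjugate_continuous[OF fc]] by metis
  have "inner y u - f y \<le> inner x u - f x" for y using x[of y] by simp
  then have "G u \<le> inner x u - f x" by (rule conjugate_least[OF fc])
  with fenchel_young[OF fc, of x u] have "G u = inner x u - f x" by simp
  then show thesis by (rule that)
qed

lemma maximiser_is_subgradient:
  assumes "\<And>u. fenchel_conjugate f u = ereal (G u)" and "G v = inner x v - f x"
  shows "G v + inner x (u - v) \<le> G u"
  using fenchel_young[OF assms(1), of x u] assms(2) by (simp add: inner_diff_right)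

lemma gradient_at_maximiser:
  assumes "\<And>u. fenchel_conjugate f u = ereal (G u)" and "G v = inner x v - f x"
    and "f differentiable (at x)"
  shows "grad f x = v"
proof -
  have "f x + inner v (y - x) \<le> f y" for y
    using fenchel_young[OF assms(1), of y v] assms(2)
    by (simp add: inner_diff_right inner_commute)
  then show ?thesis using subgradient_eq_gradient[OF GDERIV_grad[OF assms(3)]] by metis
qed

section \<open>From strong convexity to a smooth conjugate\<close>

lemma strongly_convex_iff:
  "strongly_convex \<mu> f \<longleftrightarrow> (\<forall>x. f differentiable (at x)) \<and>
     (\<forall>x y. f y + inner (grad f y) (x - y) + \<mu> / 2 * (norm (x - y))\<^sup>2 \<le> f x)"
proof -
  have "GDERIV phi0 y :> y" for y :: 'a
    unfolding gderiv_def phi0_def power2_norm_eq_inner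
    by (auto intro!: derivative_eq_intros simp: inner_commute)
  then have "grad phi0 y = y" for y :: 'a by (rule grad_eqI)
  then have "bregman phi0 x y = 1 / 2 * (norm (x - y))\<^sup>2" for x y :: 'a
    by (simp add: bregman_def phi0_def power2_norm_eq_inner inner_diff_left inner_diff_right
        inner_commute field_simps)
  then have eq: "\<mu> * bregman phi0 x y = \<mu> / 2 * (norm (x - y))\<^sup>2" for x y :: 'a by simp
  have "\<mu> * bregman phi0 x y \<le> bregman f x y \<longleftrightarrow>
      f y + inner (grad f y) (x - y) + \<mu> / 2 * (norm (x - y))\<^sup>2 \<le> f x" for x y
    unfolding eq bregman_def[of f] by linarith
  then show ?thesis unfolding strongly_convex_def by simp
qed

text \<open>Young's inequality, in the form that conjugates the quadratic \<open>\<mu>/2 * (norm d)\<^sup>2\<close>.\<close>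

lemma inner_le_quadratics:
  fixes d w :: "'a::real_inner"
  assumes "\<mu> > 0"
  shows "inner d w \<le> \<mu> / 2 * (norm d)\<^sup>2 + 1 / (2 * \<mu>) * (norm w)\<^sup>2"
proof -
  have "0 \<le> 1 / (2 * \<mu>) * (norm (\<mu> *\<^sub>R d - w))\<^sup>2" using assms by simp
  also have "\<dots> = \<mu> / 2 * (norm d)\<^sup>2 + 1 / (2 * \<mu>) * (norm w)\<^sup>2 - inner d w"
    using assms by (simp add: power2_norm_eq_inner inner_diff_left inner_diff_right
        inner_commute field_simps)
  finally show ?thesis by simp
qed

lemma strongly_convex_imp_conjugate_finite:
  assumes "\<mu> > 0" and "strongly_convex \<mu> f"
  shows "\<bar>fenchel_conjugate f u\<bar> \<noteq> \<infinity>"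
proof (rule conjugate_finiteI)
  define c where "c = 1 / (2 * \<mu>) * (norm (u - grad f 0))\<^sup>2 - f 0"
  have "inner x u - f x \<le> c" for x
  proof -
    have "f 0 + inner (grad f 0) x + \<mu> / 2 * (norm x)\<^sup>2 \<le> f x"
      using assms(2) unfolding strongly_convex_iff by (metis diff_zero)
    then show ?thesis
      using inner_le_quadratics[OF assms(1), of x "u - grad f 0"]
      by (simp add: c_def inner_diff_right inner_commute)
  qed
  then have "fenchel_conjugate f u \<le> ereal c"
    unfolding fenchel_conjugate_def by (auto intro: SUP_least)
  then show "fenchel_conjugate f u < \<infinity>" by auto
qed

text \<open>A maximiser is a subgradient, so the assumed upper bound completes a sandwich that identifies
  it as the gradient.\<close>

lemma quadratic_upper_bounds_imp_smooth:
  fixes f G :: "'a::euclidean_space \<Rightarrow> real"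
  assumes fc: "\<And>u. fenchel_conjugate f u = ereal (G u)" and cf: "continuous_on UNIV f"
    and upper: "\<And>x u v. G v = inner x v - f x \<Longrightarrow>
      G u \<le> G v + inner x (u - v) + K * (norm (u - v))\<^sup>2"
  shows "G differentiable (at v)"
    and "G u \<le> G v + inner (grad G v) (u - v) + K * (norm (u - v))\<^sup>2"
proof -
  obtain x where x: "G v = inner x v - f x" using conjugate_attained[OF fc cf] .
  have D: "GDERIV G v :> x"
    using maximiser_is_subgradient[OF fc x] upper[OF x] by (rule GDERIV_of_quadratic_sandwich)
  then show "G differentiable (at v)" unfolding gderiv_def differentiable_def by blast
  show "G u \<le> G v + inner (grad G v) (u - v) + K * (norm (u - v))\<^sup>2"
    using upper[OF x] grad_eqI[OF D] by simp
qed

lemma strongly_convex_imp_upper_bound: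
  fixes f G :: "'a::euclidean_space \<Rightarrow> real"
  assumes "\<mu> > 0" and fc: "\<And>u. fenchel_conjugate f u = ereal (G u)"
    and sc: "strongly_convex \<mu> f" and x: "G v = inner x v - f x"
  shows "G u \<le> G v + inner x (u - v) + 1 / (2 * \<mu>) * (norm (u - v))\<^sup>2"
proof (rule conjugate_least[OF fc])
  fix y
  have g: "grad f x = v"
    using gradient_at_maximiser[OF fc x] sc unfolding strongly_convex_iff by blast
  have "f x + inner v (y - x) + \<mu> / 2 * (norm (y - x))\<^sup>2 \<le> f y"
    using sc unfolding strongly_convex_iff g[symmetric] by blast
  then show "inner y u - f y \<le> G v + inner x (u - v) + 1 / (2 * \<mu>) * (norm (u - v))\<^sup>2"
    using inner_le_quadratics[OF assms(1), of "y - x" "u - v"] x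
    by (simp add: inner_diff_right inner_diff_left inner_commute)
qed

section \<open>From a smooth conjugate to strong convexity\<close>

text \<open>Differentiability of the conjugate forces \<open>f\<close> to coincide with its biconjugate: the point \<open>v\<close>
  that minimises \<open>G - \<langle>y, \<cdot>\<rangle>\<close> has \<open>y\<close> as its only subgradient, so the maximiser belonging to \<open>v\<close> can
  only be \<open>y\<close>.\<close>

lemma conjugate_maximiser_at:
  fixes f G :: "'a::euclidean_space \<Rightarrow> real"
  assumes fc: "\<And>u. fenchel_conjugate f u = ereal (G u)" and cf: "continuous_on UNIV f"
    and dG: "\<And>u. G differentiable (at u)"
  obtains v where "G v = inner y v - f y" and "grad G v = y"
proof -
  have fy: "inner u x \<le> G u + f x" for u x
    using fenchel_young[OF fc, of x u] by (simp add: inner_commute add.commute)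
  obtain v where v: "\<And>u. G v - inner v y \<le> G u - inner u y"
    using attains_tilted_minimum[of G f, OF fy conjugate_continuous[OF fc] cf] by metis
  have "G v + inner y (u - v) \<le> G u" for u
    using v[of u] by (simp add: inner_diff_right inner_commute)
  then have y: "y = grad G v" by (rule subgradient_eq_gradient[OF GDERIV_grad[OF dG]])
  obtain x where x: "G v = inner x v - f x" using conjugate_attained[OF fc cf] .
  have "x = grad G v"
    using maximiser_is_subgradient[OF fc x]
    by (rule subgradient_eq_gradient[OF GDERIV_grad[OF dG]])
  with x y that show thesis by simp
qed

lemma smooth_conjugate_imp_strongly_convex:
  fixes f G :: "'a::euclidean_space \<Rightarrow> real"
  assumes "\<mu> > 0" and df: "\<And>x. f differentiable (at x)"
    and fc: "\<And>u. fenchel_conjugate f u = ereal (G u)"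
    and dG: "\<And>u. G differentiable (at u)"
    and upper: "\<And>u v. G u \<le> G v + inner (grad G v) (u - v) + 1 / (2 * \<mu>) * (norm (u - v))\<^sup>2"
  shows "strongly_convex \<mu> f"
  unfolding strongly_convex_iff
proof (intro conjI allI)
  fix x y
  have cf: "continuous_on UNIV f"
    by (rule continuous_at_imp_continuous_on) (simp add: df differentiable_imp_continuous_within)
  obtain v where v: "G v = inner y v - f y" "grad G v = y"
    using conjugate_maximiser_at[OF fc cf dG] .
  have g: "grad f y = v" by (rule gradient_at_maximiser[OF fc v(1) df])
  \<comment> \<open>This \<open>u\<close> maximises the lower bound on \<open>f x\<close> that results from the upper bound on \<open>G u\<close>.\<close>
  define u where "u = v + \<mu> *\<^sub>R (x - y)"
  have "inner x u \<le> f x + G u" by (rule fenchel_young[OF fc])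
  moreover have "1 / (2 * \<mu>) * (norm (u - v))\<^sup>2 = \<mu> / 2 * (norm (x - y))\<^sup>2"
    using assms(1) by (simp add: u_def power_mult_distrib) (simp add: power2_eq_square)
  moreover have "inner x u - inner y u = inner v (x - y) + \<mu> * (norm (x - y))\<^sup>2"
    by (simp add: u_def inner_add_right power2_norm_eq_inner inner_diff_left inner_diff_right
        inner_commute right_diff_distrib distrib_left)
  ultimately show "f y + inner (grad f y) (x - y) + \<mu> / 2 * (norm (x - y))\<^sup>2 \<le> f x"
    using upper[of u v] unfolding v g by (simp add: inner_diff_right)
qed (rule df)

section \<open>Equivalent forms of smoothness of the conjugate\<close>

text \<open>Subtracting from \<open>G\<close>, along the segment from \<open>v\<close> to \<open>u\<close>, the claimed bound leaves a function of
  one variable that the monotonicity estimate makes nonincreasing.\<close>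

lemma gradient_bound_imp_upper_bound:
  fixes G :: "'a::euclidean_space \<Rightarrow> real"
  assumes dG: "\<And>u. G differentiable (at u)"
    and bound: "\<And>u v. inner (grad G u - grad G v) (u - v) \<le> 2 * K * (norm (u - v))\<^sup>2"
  shows "G u \<le> G v + inner (grad G v) (u - v) + K * (norm (u - v))\<^sup>2"
proof -
  define d where "d = u - v"
  define p where "p = (\<lambda>t. G (v + t *\<^sub>R d) - t * inner (grad G v) d - t\<^sup>2 * (K * (norm d)\<^sup>2))"
  have der: "(p has_real_derivative
      inner (grad G (v + t *\<^sub>R d)) d - inner (grad G v) d - 2 * t * (K * (norm d)\<^sup>2)) (at t)" for t
  proof -
    have D: "(G has_derivative (\<lambda>h. inner h (grad G (v + t *\<^sub>R d)))) (at (v + t *\<^sub>R d))"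
      using GDERIV_grad[OF dG] unfolding gderiv_def .
    have "((\<lambda>t. v + t *\<^sub>R d) has_derivative (\<lambda>s. s *\<^sub>R d)) (at t)"
      by (auto intro!: derivative_eq_intros)
    from has_derivative_compose[OF this D]
    have "((\<lambda>t. G (v + t *\<^sub>R d)) has_real_derivative inner (grad G (v + t *\<^sub>R d)) d) (at t)"
      unfolding has_field_derivative_def by (simp add: inner_commute mult_commute_abs)
    then show ?thesis
      unfolding p_def by (auto intro!: derivative_eq_intros)
  qed
  have "p 1 \<le> p 0"
  proof (rule DERIV_nonpos_imp_nonincreasing[where f = p and a = 0 and b = 1])
    fix t :: real assume t: "0 \<le> t" "t \<le> 1"
    have "inner (grad G (v + t *\<^sub>R d)) d - inner (grad G v) d - 2 * t * (K * (norm d)\<^sup>2) \<le> 0"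
    proof (cases "t = 0")
      case False
      have "t * inner (grad G (v + t *\<^sub>R d) - grad G v) d \<le> t * (2 * t * (K * (norm d)\<^sup>2))"
        using bound[of "v + t *\<^sub>R d" v] by (simp add: power_mult_distrib power2_eq_square mult_ac)
      then show ?thesis using t False by (simp add: inner_diff_left)
    qed simp
    with der show "\<exists>y. (p has_real_derivative y) (at t) \<and> y \<le> 0" by blast
  qed simp
  then show ?thesis by (simp add: p_def d_def)
qed

lemma upper_bound_imp_gradient_bound:
  fixes G :: "'a::euclidean_space \<Rightarrow> real"
  assumes "\<And>u v. G u \<le> G v + inner (grad G v) (u - v) + K * (norm (u - v))\<^sup>2"
  shows "inner (grad G u - grad G v) (u - v) \<le> 2 * K * (norm (u - v))\<^sup>2"
  using assms[of u v] assms[of v u]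
  by (simp add: inner_diff_left inner_diff_right norm_minus_commute)

text \<open>Averaging the bounds for \<open>u\<close> and \<open>v\<close> taken at their convex combination cancels the gradient.\<close>

lemma upper_bound_imp_near_concave:
  fixes G :: "'a::euclidean_space \<Rightarrow> real"
  assumes upper: "\<And>u v. G u \<le> G v + inner (grad G v) (u - v) + K * (norm (u - v))\<^sup>2"
    and t: "0 \<le> t" "t \<le> 1"
  shows "t * G u + (1 - t) * G v - K * t * (1 - t) * (norm (u - v))\<^sup>2
    \<le> G (t *\<^sub>R u + (1 - t) *\<^sub>R v)"
proof -
  define w where "w = t *\<^sub>R u + (1 - t) *\<^sub>R v"
  have uw: "u - w = (1 - t) *\<^sub>R (u - v)" and vw: "v - w = (- t) *\<^sub>R (u - v)"
    by (simp_all add: w_def algebra_simps)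
  define i where "i = inner (grad G w) (u - v)"
  define N where "N = (norm (u - v))\<^sup>2"
  have "G u \<le> G w + (1 - t) * i + K * ((1 - t)\<^sup>2 * N)"
    using upper[of u w] by (simp add: uw i_def N_def power_mult_distrib)
  then have "t * G u \<le> t * (G w + (1 - t) * i + K * ((1 - t)\<^sup>2 * N))"
    using t by (intro mult_left_mono) auto
  moreover have "G v \<le> G w - t * i + K * (t\<^sup>2 * N)"
    using upper[of v w] unfolding vw by (simp add: i_def N_def power_mult_distrib)
  then have "(1 - t) * G v \<le> (1 - t) * (G w - t * i + K * (t\<^sup>2 * N))"
    using t by (intro mult_left_mono) auto
  moreover have "t * (G w + (1 - t) * i + K * ((1 - t)\<^sup>2 * N)) +
      (1 - t) * (G w - t * i + K * (t\<^sup>2 * N)) = G w + K * t * (1 - t) * N"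
    by (simp add: power2_eq_square algebra_simps)
  ultimately show ?thesis unfolding w_def[symmetric] N_def by linarith
qed

text \<open>Write \<open>v\<close> as a convex combination of \<open>u\<close> and of \<open>v - s *\<^sub>R (u - v)\<close>, bound \<open>G\<close> at the latter from
  below by the subgradient inequality, and let \<open>s\<close> tend to \<open>0\<close>.\<close>

lemma near_concave_imp_upper_bound:
  fixes G :: "'a::euclidean_space \<Rightarrow> real"
  assumes concave: "\<And>u v t. 0 \<le> t \<Longrightarrow> t \<le> 1 \<Longrightarrow>
      t * G u + (1 - t) * G v - K * t * (1 - t) * (norm (u - v))\<^sup>2 \<le> G (t *\<^sub>R u + (1 - t) *\<^sub>R v)"
    and lower: "\<And>u. G v + inner x (u - v) \<le> G u"
  shows "G u \<le> G v + inner x (u - v) + K * (norm (u - v))\<^sup>2"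
proof -
  define i where "i = inner x (u - v)"
  define N where "N = (norm (u - v))\<^sup>2"
  have bound: "G u \<le> G v + i + K * N + s * (K * N)" if s: "s > 0" for s
  proof -
    define w where "w = v - s *\<^sub>R (u - v)"
    define t where "t = s / (1 + s)"
    have t: "0 \<le> t" "t \<le> 1" "t * (1 + s) = s" "1 - t = 1 / (1 + s)"
      using s by (auto simp: t_def field_simps)
    have "t *\<^sub>R u + (1 - t) *\<^sub>R w = v + (t - (1 - t) * s) *\<^sub>R (u - v)"
      by (simp add: w_def algebra_simps)
    also have "t - (1 - t) * s = 0" using t(3) by (simp add: algebra_simps)
    finally have v: "t *\<^sub>R u + (1 - t) *\<^sub>R w = v" by simp
    have "u - w = (1 + s) *\<^sub>R (u - v)" by (simp add: w_def algebra_simps)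
    then have n: "(norm (u - w))\<^sup>2 = (1 + s)\<^sup>2 * N" by (simp add: N_def power_mult_distrib)
    have e1: "(1 - t) * (1 + s) = 1" using t(3) by (simp add: algebra_simps)
    have "t * G u + (1 - t) * G w - K * t * (1 - t) * ((1 + s)\<^sup>2 * N) \<le> G v"
      using concave[OF t(1,2), of u w] unfolding v n .
    then have "(1 + s) * (t * G u + (1 - t) * G w - K * t * (1 - t) * ((1 + s)\<^sup>2 * N))
        \<le> (1 + s) * G v"
      using s by (intro mult_left_mono) auto
    also have "(1 + s) * (t * G u + (1 - t) * G w - K * t * (1 - t) * ((1 + s)\<^sup>2 * N)) =
        (t * (1 + s)) * G u + ((1 - t) * (1 + s)) * G w
        - (t * (1 + s)) * ((1 - t) * (1 + s)) * ((1 + s) * (K * N))"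
      by (simp add: power2_eq_square algebra_simps)
    finally have "s * G u + G w - s * ((1 + s) * (K * N)) \<le> (1 + s) * G v"
      unfolding e1 t(3) by simp
    moreover have "G v - s * i \<le> G w"
      using lower[of w] by (simp add: w_def i_def)
    ultimately have "s * G u \<le> s * (G v + i + K * N + s * (K * N))"
      by (simp add: algebra_simps)
    then show ?thesis using s by simp
  qed
  have "((\<lambda>s. G v + i + K * N + s * (K * N)) \<longlongrightarrow> G v + i + K * N + 0 * (K * N)) (at_right 0)"
    by (intro tendsto_intros)
  moreover have "\<forall>\<^sub>F s in at_right 0. G u \<le> G v + i + K * N + s * (K * N)"
    using bound by (auto simp: eventually_at_filter)
  ultimately have "G u \<le> G v + i + K * N + 0 * (K * N)"
    by (rule tendsto_lowerbound) simp
  then show ?thesis by (simp add: i_def N_def)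
qed

text \<open>A proper near-concave function cannot be infinite at \<open>v\<close>: a point \<open>u\<close> where it is finite
  is the midpoint of \<open>v\<close> and its reflection in \<open>u\<close>.\<close>

lemma near_concave_imp_finite:
  fixes F :: "'a::euclidean_space \<Rightarrow> ereal"
  assumes "proper F"
    and concave: "\<And>u v t. 0 \<le> t \<Longrightarrow> t \<le> 1 \<Longrightarrow>
      ereal t * F u + ereal (1 - t) * F v - ereal (K * t * (1 - t) * (norm (u - v))\<^sup>2)
        \<le> F (t *\<^sub>R u + (1 - t) *\<^sub>R v)"
  shows "\<bar>F v\<bar> \<noteq> \<infinity>"
proof
  assume "\<bar>F v\<bar> = \<infinity>"
  then have v: "F v = \<infinity>" using assms(1) by (cases "F v") (auto simp: proper_def)
  obtain u where u: "F u \<noteq> \<infinity>" using assms(1) by (auto simp: proper_def)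
  define w where "w = 2 *\<^sub>R u - v"
  have m: "(1/2) *\<^sub>R v + (1 - 1/2) *\<^sub>R w = u" by (simp add: w_def scaleR_diff_right)
  have "F w \<noteq> -\<infinity>" using assms(1) by (simp add: proper_def)
  then have "ereal (1 - 1/2) * F w \<noteq> -\<infinity>" by (cases "F w") auto
  then have "ereal (1/2) * F v + ereal (1 - 1/2) * F w
      - ereal (K * (1/2) * (1 - 1/2) * (norm (v - w))\<^sup>2) = \<infinity>"
    by (cases "ereal (1 - 1/2) * F w") (auto simp: v)
  with concave[of "1/2" v w] u show False unfolding m by simp
qed

section \<open>The characterisations\<close>

theorem proposition3p4:
  fixes f :: "real ^ 'n \<Rightarrow> real" and \<mu> :: real
  assumes "\<mu> > 0"
    and "\<forall>x. f differentiable (at x)"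
  shows
    "(strongly_convex \<mu> f \<longleftrightarrow>
        proper (fenchel_conjugate f) \<and>
        (\<forall>u v. \<forall>t\<in>{0..1::real}.
           fenchel_conjugate f (t *\<^sub>R u + (1 - t) *\<^sub>R v) \<ge>
             ereal t * fenchel_conjugate f u + ereal (1 - t) * fenchel_conjugate f v
             - ereal (1 / (2 * \<mu>) * t * (1 - t) * (norm (u - v))\<^sup>2))) \<and>
     (strongly_convex \<mu> f \<longleftrightarrow>
        (\<forall>u. edifferentiable_at (fenchel_conjugate f) u) \<and>
        (\<forall>u v.
           inner (egrad (fenchel_conjugate f) u - egrad (fenchel_conjugate f) v) (u - v)
             \<le> 1 / \<mu> * (norm (u - v))\<^sup>2)) \<and>
     (strongly_convex \<mu> f \<longleftrightarrow>
        (\<forall>u. edifferentiable_at (fenchel_conjugate f) u) \<and>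
        (\<forall>u v.
           fenchel_conjugate f u \<le>
             fenchel_conjugate f v + ereal (inner (egrad (fenchel_conjugate f) v) (u - v))
             + ereal (1 / (2 * \<mu>) * (norm (u - v))\<^sup>2)))"
proof -
  define F where "F = fenchel_conjugate f"
  define G where "G = (\<lambda>u. real_of_ereal (F u))"
  define K where "K = 1 / (2 * \<mu>)"
  have df: "f differentiable (at x)" for x using assms(2) by blast
  then have cf: "continuous_on UNIV f"
    by (simp add: continuous_at_imp_continuous_on differentiable_imp_continuous_within)
  define smooth where "smooth \<longleftrightarrow> (\<forall>u. F u = ereal (G u)) \<and> (\<forall>u. G differentiable (at u)) \<and>
    (\<forall>u v. G u \<le> G v + inner (grad G v) (u - v) + K * (norm (u - v))\<^sup>2)"
  have fin: "F u = ereal (G u)" if "\<bar>F u\<bar> \<noteq> \<infinity>" for u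
    using that unfolding G_def by (simp add: ereal_real')
  have ediff_at: "edifferentiable_at F u \<longleftrightarrow>
      (\<forall>\<^sub>F w in nhds u. \<bar>F w\<bar> \<noteq> \<infinity>) \<and> G differentiable (at u)" for u
    by (simp add: edifferentiable_at_def G_def)
  have ediff: "(\<forall>u. edifferentiable_at F u) \<longleftrightarrow>
      (\<forall>u. F u = ereal (G u)) \<and> (\<forall>u. G differentiable (at u))"
  proof
    assume *: "\<forall>u. edifferentiable_at F u"
    have "F u = ereal (G u)" for u
    proof (rule fin)
      have "\<forall>\<^sub>F w in nhds u. \<bar>F w\<bar> \<noteq> \<infinity>" using * unfolding ediff_at by blast
      then show "\<bar>F u\<bar> \<noteq> \<infinity>" by (rule eventually_nhds_x_imp_x)
    qed
    with * show "(\<forall>u. F u = ereal (G u)) \<and> (\<forall>u. G differentiable (at u))"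
      unfolding ediff_at by blast
  next
    assume "(\<forall>u. F u = ereal (G u)) \<and> (\<forall>u. G differentiable (at u))"
    then show "\<forall>u. edifferentiable_at F u" unfolding ediff_at by simp
  qed
  have egrad: "egrad F u = grad G u" for u by (simp add: egrad_def G_def)

  have sc: "strongly_convex \<mu> f \<longleftrightarrow> smooth"
  proof
    assume sc: "strongly_convex \<mu> f"
    have fc: "fenchel_conjugate f u = ereal (G u)" for u
      using strongly_convex_imp_conjugate_finite[OF assms(1) sc] fin F_def by simp
    have "G u \<le> G v + inner x (u - v) + K * (norm (u - v))\<^sup>2" if "G v = inner x v - f x" for x u v
      using strongly_convex_imp_upper_bound[OF assms(1) fc sc that] by (simp add: K_def)
    from quadratic_upper_bounds_imp_smooth[OF fc cf this]
    show smooth unfolding smooth_def using fc F_def by simp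
  next
    assume smooth
    then show "strongly_convex \<mu> f"
      using smooth_conjugate_imp_strongly_convex[of \<mu> f G] assms(1) df
      unfolding smooth_def K_def F_def by blast
  qed

  have a: "smooth \<longleftrightarrow> proper F \<and> (\<forall>u v. \<forall>t\<in>{0..1::real}. F (t *\<^sub>R u + (1 - t) *\<^sub>R v) \<ge>
      ereal t * F u + ereal (1 - t) * F v - ereal (K * t * (1 - t) * (norm (u - v))\<^sup>2))"
    (is "_ \<longleftrightarrow> proper F \<and> ?near_concave")
  proof
    assume s: smooth
    then have FG: "F = (\<lambda>u. ereal (G u))" by (auto simp: smooth_def)
    have "proper F" unfolding FG by (simp add: proper_def)
    moreover have ?near_concave
      using upper_bound_imp_near_concave[of G K] s unfolding FG smooth_def by auto
    ultimately show "proper F \<and> ?near_concave" by blast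
  next
    assume *: "proper F \<and> ?near_concave"
    then have FG: "F u = ereal (G u)" for u
      using near_concave_imp_finite[of F K] fin by auto
    then have fc: "fenchel_conjugate f u = ereal (G u)" for u by (simp add: F_def)
    have concave: "t * G u + (1 - t) * G v - K * t * (1 - t) * (norm (u - v))\<^sup>2
        \<le> G (t *\<^sub>R u + (1 - t) *\<^sub>R v)" if "0 \<le> t" "t \<le> 1" for u v t
      using * that unfolding FG by simp
    have "G u \<le> G v + inner x (u - v) + K * (norm (u - v))\<^sup>2" if "G v = inner x v - f x" for x u v
      using concave maximiser_is_subgradient[OF fc that] by (rule near_concave_imp_upper_bound)
    from quadratic_upper_bounds_imp_smooth[OF fc cf this] FG
    show smooth unfolding smooth_def by blast
  qed

  have b: "smooth \<longleftrightarrow> (\<forall>u. edifferentiable_at F u) \<and>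
      (\<forall>u v. inner (egrad F u - egrad F v) (u - v) \<le> 2 * K * (norm (u - v))\<^sup>2)"
    unfolding ediff egrad smooth_def
    using gradient_bound_imp_upper_bound[of G K] upper_bound_imp_gradient_bound[of G K] by blast

  have c: "smooth \<longleftrightarrow> (\<forall>u. edifferentiable_at F u) \<and>
      (\<forall>u v. F u \<le> F v + ereal (inner (egrad F v) (u - v)) + ereal (K * (norm (u - v))\<^sup>2))"
    unfolding ediff egrad smooth_def by auto

  have "2 * K = 1 / \<mu>" by (simp add: K_def)
  with sc a b c show ?thesis unfolding F_def K_def by simp
qed

end
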